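(* Let $D\subseteq [0,\infty)^n$ be a rectangular set and denote $$D_0:=\{(t_1,\dots,t_n)\in D\mid t_1\cdots t_n=0\}.$$ Let $F\colon D\times\mathbb{R}^m\to\mathbb{R}^m$ be a continuous map which fulfills the Lipschitz condition $$\|F(t,x)-F(t,y)\|\le L(t)\,\|x-y\|$$ for all $t\in D$ and $x,y\in\mathbb{R}^m$, with a continuous function $L\colon D\to\mathbb{R}_+$, and let $\varphi\colon D_0\to\mathbb{R}^m$ be a continuous function such that the partial derivatives $\partial_n\varphi$, $\partial_{n-1}\partial_n\varphi$, \dots, $\partial_2\cdots\partial_n\varphi$ exist on $D_0$. Then there exists precisely one continuous solution $x\colon D\to\mathbb{R}^m$ of the Cauchy problem $$\partial_1\cdots\partial_n x(t)=F\bigl(t,x(t)\bigr)\quad\text{on } D,\qquad x(t)=\varphi(t)\quad\text{on } D_0.$$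
   Context: $\mathbb{R}_+$ denotes the set of positive reals; $n,m$ are positive integers. For $a,b\in\mathbb{R}^n$, $a\le b$ means that all coordinates of $b-a$ are nonnegative, and then $[a,b]:=\{u\in\mathbb{R}^n\mid a\le u\le b\}$. A set $D\subseteq[0,\infty)^n$ is rectangular (with respect to the origin) if for all $u\in D$ the rectangle $[0,u]$ is contained in $D$, and the set $[0,\infty)^n\setminus D$ is closed in $\mathbb{R}^n$. $\partial_k$ denotes the partial derivative with respect to the $k$th variable, one-sided at points where $t_k=0$. Iterated derivatives are taken in the indicated order, rightmost first: a solution $x$ of the Cauchy problem is a function for which $\partial_n x$, $\partial_{n-1}\partial_n x$, \dots, $\partial_1\cdots\partial_n x$ exist on $D$ and the two equalities hold. For $2\le k\le n$, existence of $\partial_k\cdots\partial_n\varphi$ on $D_0$ is understood at those points of $D_0$ where this iterated derivative is meaningful, i.e. on $\{t\in D\mid t_1\cdots t_{k-1}=0\}$ (a subset of $D_0$ from which varying $t_k,\dots,t_n$ within $D$ does not leave $D_0$). For $n=1$ there is no differentiability condition on $\varphi$. *)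

theory Defs
  imports "HOL-Analysis.Analysis"
begin

text \<open>
  Points of \<open>\<real>\<^sup>n\<close> are vectors \<^typ>\<open>real ^ 'n\<close> over a finite linearly ordered index type
  \<open>'n\<close>, whose elements in increasing order play the role of \<open>1, \<dots>, n\<close>. The order on
  vectors is the library's coordinatewise one.
\<close>

definition rectangular :: "(real ^ 'n) set \<Rightarrow> bool" where
  "rectangular D \<longleftrightarrow> D \<subseteq> {0..} \<and> (\<forall>u\<in>D. {0..u} \<subseteq> D) \<and> closed ({0..} - D)"

definition zero_face :: "(real ^ 'n) set \<Rightarrow> (real ^ 'n) set" where
  "zero_face D = {t \<in> D. (\<Prod>i\<in>UNIV. t $ i) = 0}"

definition vec_upd :: "real ^ 'n \<Rightarrow> 'n \<Rightarrow> real \<Rightarrow> real ^ 'n" where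
  "vec_upd t k s = (\<chi> i. if i = k then s else t $ i)"

text \<open>
  The partial derivative at \<open>t\<close> is taken along the part of the coordinate line through
  \<open>t\<close> that lies in \<open>D\<close>. For rectangular \<open>D\<close> and \<open>t \<in> D\<close> this part is an interval
  containing \<open>0\<close> and relatively open in \<open>[0, \<infinity>)\<close>, so the derivative is two-sided if
  \<open>t\<^sub>k > 0\<close>, one-sided if \<open>t\<^sub>k = 0\<close>, and unique. The value of \<open>partial_deriv\<close> is
  meaningful only where \<open>partially_differentiable\<close> holds.
\<close>

definition partially_differentiable ::
  "(real ^ 'n) set \<Rightarrow> 'n \<Rightarrow> (real ^ 'n \<Rightarrow> 'a::real_normed_vector) \<Rightarrow> real ^ 'n \<Rightarrow> bool" where
  "partially_differentiable D k f t \<longleftrightarrow>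
     (\<lambda>s. f (vec_upd t k s)) differentiable (at (t $ k) within {s. vec_upd t k s \<in> D})"

definition partial_deriv ::
  "(real ^ 'n) set \<Rightarrow> 'n \<Rightarrow> (real ^ 'n \<Rightarrow> 'a::real_normed_vector) \<Rightarrow> real ^ 'n \<Rightarrow> 'a" where
  "partial_deriv D k f t =
     vector_derivative (\<lambda>s. f (vec_upd t k s)) (at (t $ k) within {s. vec_upd t k s \<in> D})"

text \<open>
  For \<open>K = {k\<^sub>1 < \<dots> < k\<^sub>r}\<close> this is \<open>\<partial>\<^bsub>k\<^sub>1\<^esub> \<dots> \<partial>\<^bsub>k\<^sub>r\<^esub> f\<close>, the derivative with respect to
  the largest index being taken first.
\<close>

definition iter_partial_deriv ::
  "(real ^ 'n::{finite,linorder}) set \<Rightarrow> 'n::{finite,linorder} set \<Rightarrow> (real ^ 'n::{finite,linorder} \<Rightarrow> 'a::real_normed_vector)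
     \<Rightarrow> real ^ 'n::{finite,linorder} \<Rightarrow> 'a" where
  "iter_partial_deriv D K f = foldr (partial_deriv D) (sorted_list_of_set K) f"

text \<open>
  Existence of \<open>\<partial>\<^sub>k \<dots> \<partial>\<^sub>n \<phi>\<close> for \<open>2 \<le> k \<le> n\<close>, each at the points with
  \<open>t\<^sub>1 \<cdots> t\<^bsub>k-1\<^esub> = 0\<close>: from there, varying \<open>t\<^sub>k, \<dots>, t\<^sub>n\<close> within \<open>D\<close> does not leave
  \<open>zero_face D\<close>, so only values of \<open>\<phi>\<close> on \<open>zero_face D\<close> enter.
\<close>

definition admissible_boundary_data ::
  "(real ^ 'n::{finite,linorder}) set \<Rightarrow> (real ^ 'n::{finite,linorder} \<Rightarrow> 'a::real_normed_vector) \<Rightarrow> bool" where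
  "admissible_boundary_data D \<phi> \<longleftrightarrow>
     continuous_on (zero_face D) \<phi> \<and>
     (\<forall>k > Min UNIV. \<forall>t \<in> {t \<in> D. (\<Prod>i<k. t $ i) = 0}.
        partially_differentiable D k (iter_partial_deriv D {k<..} \<phi>) t)"

definition cauchy_solution ::
  "(real ^ 'n::{finite,linorder}) set \<Rightarrow> ((real ^ 'n::{finite,linorder}) \<times> 'a::real_normed_vector \<Rightarrow> 'a)
     \<Rightarrow> (real ^ 'n::{finite,linorder} \<Rightarrow> 'a) \<Rightarrow> (real ^ 'n::{finite,linorder} \<Rightarrow> 'a) \<Rightarrow> bool" where
  "cauchy_solution D F \<phi> x \<longleftrightarrow>
     (\<forall>k. \<forall>t\<in>D. partially_differentiable D k (iter_partial_deriv D {k<..} x) t) \<and>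
     (\<forall>t\<in>D. iter_partial_deriv D UNIV x t = F (t, x t)) \<and>
     (\<forall>t\<in>zero_face D. x t = \<phi> t)"

end

theory Submission imports Defs begin

text \<open>
  Inclusion--exclusion over the faces extends \<open>\<phi>\<close> to
  \<open>\<Phi>(t) = \<Sum>\<^bsub>S \<noteq> {}\<^esub> (-1)\<^bsup>|S|+1\<^esup> \<phi>(t with the coordinates in S set to 0)\<close>, which agrees with
  \<open>\<phi>\<close> on the faces and has \<open>\<partial>\<^sub>1 \<cdots> \<partial>\<^sub>n \<Phi> = 0\<close>. The Cauchy problem then becomes the
  integral equation \<open>x = \<Phi> + J F(\<cdot>, x)\<close>, where \<open>J\<close> integrates successively along the
  coordinates \<open>1, \<dots>, n\<close> from \<open>0\<close>. On each rectangle \<open>[0, u]\<close> the right-hand side is a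
  contraction with factor \<open>1/2\<close> for the norm weighted by \<open>exp (\<mu> (t\<^sub>1 + \<dots> + t\<^sub>n))\<close> with
  large \<open>\<mu>\<close>, so the Picard iterates converge locally uniformly on \<open>D\<close>.
\<close>

section \<open>Changing one coordinate and setting coordinates to zero\<close>

lemma vec_upd_nth: "vec_upd t k s $ i = (if i = k then s else t $ i)"
  by (simp add: vec_upd_def)

lemma vec_upd_same [simp]: "vec_upd t k (t $ k) = t"
  by (simp add: vec_eq_iff vec_upd_nth)

lemma vec_upd_upd [simp]: "vec_upd (vec_upd t k s) k r = vec_upd t k r"
  by (simp add: vec_eq_iff vec_upd_nth)

lemma continuous_on_vec_upd:
  assumes "continuous_on S f" "continuous_on S g"
  shows "continuous_on S (\<lambda>x. vec_upd (f x) k (g x))"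
proof -
  have "continuous_on S (\<lambda>x. if i = k then g x else f x $ i)" for i
    using assms by (cases "i = k") (auto intro!: continuous_intros)
  then show ?thesis
    unfolding vec_upd_def by (intro continuous_on_vec_lambda)
qed

definition zero_coords :: "'n set \<Rightarrow> real ^ 'n \<Rightarrow> real ^ 'n" where
  "zero_coords S t = (\<chi> i. if i \<in> S then 0 else t $ i)"

lemma zero_coords_nth: "zero_coords S t $ i = (if i \<in> S then 0 else t $ i)"
  by (simp add: zero_coords_def)

lemma continuous_on_zero_coords: "continuous_on A (zero_coords S)"
proof -
  have "continuous_on A (\<lambda>t. if i \<in> S then 0 else t $ i :: real)" for i
    by (cases "i \<in> S") (auto intro!: continuous_intros)
  then show ?thesis
    unfolding zero_coords_def [abs_def] by (intro continuous_on_vec_lambda)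
qed

lemma zero_coords_vec_upd_in: "k \<in> S \<Longrightarrow> zero_coords S (vec_upd t k s) = zero_coords S t"
  by (simp add: vec_eq_iff vec_upd_nth zero_coords_nth)

lemma zero_coords_vec_upd_notin:
  "k \<notin> S \<Longrightarrow> zero_coords S (vec_upd t k s) = vec_upd (zero_coords S t) k s"
  by (simp add: vec_eq_iff vec_upd_nth zero_coords_nth)

section \<open>Integration along coordinates\<close>

definition coord_integral ::
  "'n \<Rightarrow> (real ^ 'n \<Rightarrow> 'a::real_normed_vector) \<Rightarrow> real ^ 'n \<Rightarrow> 'a" where
  "coord_integral k f t = integral {0..t $ k} (\<lambda>s. f (vec_upd t k s))"

text \<open>\<open>fold\<close> integrates in the smallest index first and leaves the largest
  outermost, while \<open>foldr\<close> in \<open>iter_partial_deriv\<close> differentiates in the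
  largest index first. Each derivative thus meets its own integral as the outermost one
  left.\<close>

definition full_integral ::
  "(real ^ 'n::{finite,linorder} \<Rightarrow> 'a::real_normed_vector) \<Rightarrow> real ^ 'n::{finite,linorder} \<Rightarrow> 'a" where
  "full_integral f = fold coord_integral (sorted_list_of_set UNIV) f"

text \<open>The integration in \<open>k\<close> runs over the degenerate interval from 0 to 0, and
  later integrations in other indices keep coordinate \<open>k\<close> at 0. This makes the integral
  term vanish on the faces, leaving only the boundary data there.\<close>

lemma fold_coord_integral_zero:
  assumes "k \<in> set ks" "t $ k = 0"
  shows "fold coord_integral ks f t = 0"
  using assms
proof (induction ks arbitrary: t rule: rev_induct)
  case (snoc j ks)
  show ?case
  proof (cases "j = k")
    case True
    then show ?thesis using snoc.prems by (simp add: coord_integral_def)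
  next
    case False
    then have "fold coord_integral ks f (vec_upd t j s) = 0" for s
      using snoc by (auto simp: vec_upd_nth)
    then show ?thesis by (simp add: coord_integral_def [of j])
  qed
qed simp

section \<open>Segments of a finite linear order\<close>

lemma sorted_list_of_set_atLeast:
  fixes k :: "'n::{finite,linorder}"
  shows "sorted_list_of_set {k..} = k # sorted_list_of_set {k<..}"
proof -
  have "{k..} - {k} = {k<..}" "Min {k..} = k"
    by (auto intro: Min_eqI)
  then show ?thesis
    by (metis atLeast_iff empty_iff finite order_refl sorted_list_of_set_nonempty)
qed

lemma sorted_list_of_set_atMost:
  fixes k :: "'n::{finite,linorder}"
  shows "sorted_list_of_set {..k} = sorted_list_of_set {..<k} @ [k]"
proof -
  have "insert k {..<k} = {..k}" by auto
  then show ?thesis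
    by (intro sorted_distinct_set_unique) (auto simp: sorted_append)
qed

lemma iter_partial_deriv_atLeast:
  "iter_partial_deriv D {k..} f = partial_deriv D k (iter_partial_deriv D {k<..} f)"
  by (simp add: iter_partial_deriv_def sorted_list_of_set_atLeast)

text \<open>The index after \<open>k\<close>, if there is one, is the minimum of the larger indices.
  Together with its mirror image \<open>lessThan_cases\<close> this supplies successor steps for
  inductions over an abstract index type.\<close>

lemma greaterThan_cases:
  fixes k :: "'n::{finite,linorder}"
  obtains "{k<..} = {}" | j where "k < j" "{k<..} = {j..}"
proof (cases "{k<..} = {}")
  case False
  then have "Min {k<..} \<in> {k<..}" by (intro Min_in) auto
  moreover have "{k<..} = {Min {k<..}..}"
    using calculation by (auto intro: Min_le order.strict_trans2)
  ultimately show ?thesis using that(2) by auto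
qed (use that in auto)

lemma lessThan_cases:
  fixes k :: "'n::{finite,linorder}"
  obtains "{..<k} = {}" | j where "j < k" "{..<k} = {..j}"
proof (cases "{..<k} = {}")
  case False
  then have "Max {..<k} \<in> {..<k}" by (intro Max_in) auto
  moreover have "{..<k} = {..Max {..<k}}"
    using calculation by (auto intro: Max_ge order.strict_trans1)
  ultimately show ?thesis using that(2) by auto
qed (use that in auto)

section \<open>Locality of iterated derivatives, derivative chains and weighted contractions\<close>

text \<open>\<open>vector_derivative\<close> is a choice term, so it is enough that both functions
  admit the same derivatives \<open>d\<close>. The equality therefore holds at points without a
  derivative as well.\<close>

lemma vector_derivative_within_cong:
  assumes "\<And>s. s \<in> S \<Longrightarrow> f s = g s" "x \<in> S"
  shows "vector_derivative f (at x within S) = vector_derivative g (at x within S)"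
proof -
  have "(f has_vector_derivative d) (at x within S) = (g has_vector_derivative d) (at x within S)" for d
    using assms has_vector_derivative_transform [of x S f g d] has_vector_derivative_transform [of x S g f d]
    by auto
  then show ?thesis by (simp add: vector_derivative_def)
qed

lemma partial_deriv_cong_line:
  assumes "\<And>s. vec_upd t k s \<in> D \<Longrightarrow> f (vec_upd t k s) = g (vec_upd t k s)" "t \<in> D"
  shows "partial_deriv D k f t = partial_deriv D k g t"
  unfolding partial_deriv_def
  using assms by (intro vector_derivative_within_cong) auto

text \<open>Differentiating in indices other than \<open>k\<close> follows lines that stay in the
  face where coordinate \<open>k\<close> is 0. Hence boundary values alone determine these
  derivatives on that face.\<close>

lemma iter_partial_deriv_cong_face:
  assumes "\<And>t. t \<in> D \<Longrightarrow> t $ k = 0 \<Longrightarrow> f t = g t" "k \<notin> K" "t \<in> D" "t $ k = 0"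
  shows "iter_partial_deriv D K f t = iter_partial_deriv D K g t"
proof -
  have "foldr (partial_deriv D) ks f t = foldr (partial_deriv D) ks g t"
    if "k \<notin> set ks" "t \<in> D" "t $ k = 0" for ks t
    using that
  proof (induction ks arbitrary: t)
    case (Cons j ks)
    then show ?case
      by (auto intro!: partial_deriv_cong_line simp: vec_upd_nth)
  qed (use assms(1) in simp)
  then show ?thesis
    using assms by (simp add: iter_partial_deriv_def)
qed

text \<open>\<open>G K\<close> plays the role of the iterated derivative of \<open>G {}\<close> in the variables \<open>K\<close>; only
  upward closed \<open>K\<close> matter.\<close>

definition deriv_chain ::
  "(real ^ 'n::{finite,linorder}) set \<Rightarrow>
    ('n set \<Rightarrow> real ^ 'n::{finite,linorder} \<Rightarrow> 'a::real_normed_vector) \<Rightarrow> bool" where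
  "deriv_chain D G \<longleftrightarrow> (\<forall>k. \<forall>t\<in>D. ((\<lambda>s. G {k<..} (vec_upd t k s)) has_vector_derivative G {k..} t)
     (at (t $ k) within {s. vec_upd t k s \<in> D}))"

lemma deriv_chain_add:
  assumes "deriv_chain D G" "deriv_chain D H"
  shows "deriv_chain D (\<lambda>K t. G K t + H K t)"
  using assms unfolding deriv_chain_def by (auto intro!: derivative_intros)

lemma deriv_chain_diff:
  assumes "deriv_chain D G" "deriv_chain D H"
  shows "deriv_chain D (\<lambda>K t. G K t - H K t)"
  using assms unfolding deriv_chain_def by (auto intro!: derivative_intros)

lemma deriv_chain_iter_partial_deriv:
  assumes "\<And>k t. t \<in> D \<Longrightarrow> partially_differentiable D k (iter_partial_deriv D {k<..} f) t"
  shows "deriv_chain D (\<lambda>K. iter_partial_deriv D K f)"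
  unfolding deriv_chain_def iter_partial_deriv_atLeast
  using assms by (auto simp: partially_differentiable_def partial_deriv_def vector_derivative_works)

text \<open>A constant \<open>C\<close> in a pointwise bound stands in for the weighted supremum
  norm on the rectangle below \<open>u\<close>. The functions live on all of \<open>D\<close>, so
  that one and the same iteration can be estimated on every rectangle, each with its own
  \<open>\<mu>\<close>.\<close>

definition exp_contraction ::
  "(real ^ 'n) set \<Rightarrow> ((real ^ 'n \<Rightarrow> 'a::real_normed_vector) \<Rightarrow> real ^ 'n \<Rightarrow> 'a) \<Rightarrow> real ^ 'n \<Rightarrow> real \<Rightarrow> bool"
  where "exp_contraction D T u \<mu> \<longleftrightarrow> (\<forall>x y C. continuous_on D x \<longrightarrow> continuous_on D y \<longrightarrow>
    (\<forall>t\<in>{0..u}. norm (x t - y t) \<le> C * exp (\<mu> * (\<Sum>i\<in>UNIV. t $ i))) \<longrightarrow>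
    (\<forall>t\<in>{0..u}. norm (T x t - T y t) \<le> C / 2 * exp (\<mu> * (\<Sum>i\<in>UNIV. t $ i))))"

lemma exp_contractionD:
  assumes "exp_contraction D T u \<mu>" "continuous_on D x" "continuous_on D y"
    "\<forall>t\<in>{0..u}. norm (x t - y t) \<le> C * exp (\<mu> * (\<Sum>i\<in>UNIV. t $ i))"
  shows "\<forall>t\<in>{0..u}. norm (T x t - T y t) \<le> C / 2 * exp (\<mu> * (\<Sum>i\<in>UNIV. t $ i))"
  using assms unfolding exp_contraction_def by blast

lemma one_le_exp_sum:
  fixes t :: "real ^ 'n"
  assumes "t \<in> {0..u}" "\<mu> \<ge> (1::real)"
  shows "1 \<le> exp (\<mu> * (\<Sum>i\<in>UNIV. t $ i))"
  using assms by (auto simp: less_eq_vec_def intro!: mult_nonneg_nonneg sum_nonneg)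

section \<open>Geometry of rectangular sets and derivatives along their coordinate lines\<close>

context
  fixes D :: "(real ^ 'n::{finite,linorder}) set"
  assumes rect: "rectangular D"
begin

lemma rectangular_nonneg: "t \<in> D \<Longrightarrow> 0 \<le> t $ i"
  using rect unfolding rectangular_def by (auto simp: less_eq_vec_def)

lemma rectangular_interval: "u \<in> D \<Longrightarrow> {0..u} \<subseteq> D"
  using rect unfolding rectangular_def by blast

lemma rectangular_below:
  assumes "u \<in> D" "\<And>i. 0 \<le> t $ i" "\<And>i. t $ i \<le> u $ i"
  shows "t \<in> D"
proof -
  have "t \<in> {0..u}" using assms by (simp add: less_eq_vec_def)
  then show ?thesis using rectangular_interval [OF assms(1)] by blast
qed

lemma zero_coords_mem: "t \<in> D \<Longrightarrow> zero_coords S t \<in> D"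
  by (rule rectangular_below) (auto simp: zero_coords_nth rectangular_nonneg)

lemma vec_upd_mem: "t \<in> D \<Longrightarrow> 0 \<le> s \<Longrightarrow> s \<le> t $ k \<Longrightarrow> vec_upd t k s \<in> D"
  by (rule rectangular_below) (auto simp: vec_upd_nth rectangular_nonneg)

text \<open>Since the complement is closed, \<open>D\<close> is relatively open in the orthant, and
  a small step from \<open>t\<close> along the diagonal stays in \<open>D\<close>.\<close>

lemma rectangular_above:
  assumes "t \<in> D"
  obtains u where "u \<in> D" "\<And>i. t $ i < u $ i"
proof -
  have "open (- ({0..} - D))" "t \<in> - ({0..} - D)"
    using rect assms unfolding rectangular_def by (auto simp only: open_Compl)
  then obtain e where e: "e > 0" "\<And>v. dist v t < e \<Longrightarrow> v \<in> - ({0..} - D)"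
    unfolding open_dist by blast
  \<comment> \<open>The product of \<open>c\<close> and the norm of the diagonal vector is at most
    \<open>e / 2\<close>; the summand 2 in the denominator keeps it visibly positive.\<close>
  define c where "c = e / (2 * norm (1 :: real ^ 'n::{finite,linorder}) + 2)"
  have pos: "2 * norm (1 :: real ^ 'n::{finite,linorder}) + 2 > 0"
    using norm_ge_zero [of "1 :: real ^ 'n::{finite,linorder}"] by linarith
  then have c: "c > 0" using e by (simp add: c_def)
  have "c * norm (1 :: real ^ 'n::{finite,linorder}) < e"
    using pos e(1) norm_ge_zero [of "1 :: real ^ 'n::{finite,linorder}"] by (simp add: c_def field_simps add_pos_nonneg)
  then have "dist (t + c *\<^sub>R 1) t < e"
    using c by (simp add: dist_norm)
  moreover have "0 \<le> t + c *\<^sub>R 1"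
    using rectangular_nonneg [OF assms] c by (simp add: less_eq_vec_def add_nonneg_nonneg)
  ultimately have "t + c *\<^sub>R 1 \<in> D" using e(2) by auto
  then show ?thesis using c by (intro that) auto
qed

text \<open>Below \<open>b\<close> the line meets \<open>D\<close> exactly in the parameters from 0
  on, so both sets give the same filter at \<open>t $ k\<close>. This reduces partial derivatives in
  \<open>D\<close> to derivatives on a nondegenerate compact interval, where they are unique and the
  fundamental theorem applies.\<close>

lemma rectangular_line:
  assumes "t \<in> D"
  obtains b where "t $ k < b" "\<And>s. 0 \<le> s \<Longrightarrow> s \<le> b \<Longrightarrow> vec_upd t k s \<in> D"
    "at (t $ k) within {s. vec_upd t k s \<in> D} = at (t $ k) within {0..b}"
proof -
  obtain u where u: "u \<in> D" "\<And>i. t $ i < u $ i"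
    using rectangular_above [OF assms] by blast
  have sub: "vec_upd t k s \<in> D" if "0 \<le> s" "s \<le> u $ k" for s
    using that u rectangular_nonneg [OF assms]
    by (intro rectangular_below [OF u(1)]) (auto simp: vec_upd_nth less_imp_le)
  have "0 \<le> s" if "vec_upd t k s \<in> D" for s
    using rectangular_nonneg [OF that, of k] by (simp add: vec_upd_nth)
  then have "at (t $ k) within {s. vec_upd t k s \<in> D} = at (t $ k) within {0..u $ k}"
    using u sub by (intro at_within_nhd [of _ "{..<u $ k}"]) auto
  then show ?thesis using u sub by (intro that) auto
qed

lemma vector_derivative_line:
  assumes "t \<in> D" "(f has_vector_derivative d) (at (t $ k) within {s. vec_upd t k s \<in> D})"
  shows "vector_derivative f (at (t $ k) within {s. vec_upd t k s \<in> D}) = d"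
proof -
  obtain b where b: "t $ k < b"
    "at (t $ k) within {s. vec_upd t k s \<in> D} = at (t $ k) within {0..b}"
    by (rule rectangular_line [OF assms(1)])
  then have "0 < b" using rectangular_nonneg [OF assms(1), of k] by linarith
  then show ?thesis
    using assms(2) b rectangular_nonneg [OF assms(1), of k]
      vector_derivative_within_cbox [of 0 b "t $ k" f d] by auto
qed

text \<open>Derivatives along lines in \<open>D\<close> are unique, so a chain of explicit
  derivatives has to coincide with the choice terms in \<open>iter_partial_deriv\<close>. The
  induction goes from the largest index downwards and keeps agreement on all of \<open>D\<close>,
  because the next derivative looks at a whole line.\<close>

lemma deriv_chain_iter:
  assumes "deriv_chain D G" "\<And>t. t \<in> D \<Longrightarrow> f t = G {} t" "t \<in> D"
  shows "iter_partial_deriv D {k<..} f t = G {k<..} t"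
    and "iter_partial_deriv D {k..} f t = G {k..} t"
    and "partially_differentiable D k (iter_partial_deriv D {k<..} f) t"
proof -
  have step: "partially_differentiable D k (iter_partial_deriv D {k<..} f) t \<and>
      iter_partial_deriv D {k..} f t = G {k..} t"
    if eq: "\<And>t. t \<in> D \<Longrightarrow> iter_partial_deriv D {k<..} f t = G {k<..} t" and t: "t \<in> D" for k t
  proof -
    have "((\<lambda>s. G {k<..} (vec_upd t k s)) has_vector_derivative G {k..} t)
        (at (t $ k) within {s. vec_upd t k s \<in> D})"
      using assms(1) t by (auto simp: deriv_chain_def)
    then have *: "((\<lambda>s. iter_partial_deriv D {k<..} f (vec_upd t k s)) has_vector_derivative G {k..} t)
        (at (t $ k) within {s. vec_upd t k s \<in> D})"
      by (rule has_vector_derivative_transform [rotated 2]) (use eq t in auto)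
    then show ?thesis
      using vector_derivative_line [OF t *]
      by (auto simp: partially_differentiable_def iter_partial_deriv_atLeast partial_deriv_def
          intro: differentiableI_vector)
  qed
  have eq: "\<forall>t\<in>D. iter_partial_deriv D {k<..} f t = G {k<..} t" for k
  proof (induction "card {k<..}" arbitrary: k rule: less_induct)
    case less
    show ?case
    proof (cases k rule: greaterThan_cases)
      case 1
      then show ?thesis by (simp add: iter_partial_deriv_def assms(2))
    next
      case (2 j)
      have "card {j<..} < card {k<..}"
        unfolding 2(2) by (intro psubset_card_mono psubsetI) (auto intro: less_imp_le)
      then have "\<forall>t\<in>D. iter_partial_deriv D {j<..} f t = G {j<..} t"
        by (rule less)
      then show ?thesis unfolding 2(2) using step [of j] by blast
    qed
  qed
  then show "iter_partial_deriv D {k<..} f t = G {k<..} t" using assms(3) by auto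
  show "iter_partial_deriv D {k..} f t = G {k..} t"
    "partially_differentiable D k (iter_partial_deriv D {k<..} f) t"
    using eq step assms(3) by blast+
qed

section \<open>Continuity, linearity and differentiation of coordinate integrals\<close>

lemma continuous_on_line:
  assumes "continuous_on D f" "\<And>s. s \<in> S \<Longrightarrow> vec_upd t k s \<in> D"
  shows "continuous_on S (\<lambda>s. f (vec_upd t k s))"
  using assms
  by (intro continuous_on_compose2 [OF assms(1)] continuous_on_vec_upd continuous_intros) auto

lemma coord_integral_cong:
  assumes "\<And>t. t \<in> D \<Longrightarrow> f t = g t" "t \<in> D"
  shows "coord_integral k f t = coord_integral k g t"
  unfolding coord_integral_def
  using assms vec_upd_mem by (intro integral_cong) auto

lemma full_integral_cong:
  assumes "\<And>t. t \<in> D \<Longrightarrow> f t = g t" "t \<in> D"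
  shows "full_integral f t = full_integral g t"
proof -
  have "\<forall>t\<in>D. fold coord_integral ks f t = fold coord_integral ks g t" for ks
    by (induction ks rule: rev_induct) (auto simp: assms(1) intro: coord_integral_cong)
  then show ?thesis using assms(2) by (simp add: full_integral_def)
qed

lemma integrable_line:
  fixes f :: "real ^ 'n::{finite,linorder} \<Rightarrow> 'a::banach"
  assumes "continuous_on D f" "t \<in> D"
  shows "(\<lambda>s. f (vec_upd t k s)) integrable_on {0..t $ k}"
  using assms vec_upd_mem
  by (intro integrable_continuous_interval continuous_on_line) auto

text \<open>The substitution \<open>s = t $ k * r\<close> moves the variable endpoint into the
  integrand. Over the fixed interval from 0 to 1, continuity in \<open>t\<close> becomes continuity
  of a parameter integral. For \<open>t $ k = 0\<close> both sides are 0.\<close>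

lemma coord_integral_rescale:
  fixes f :: "real ^ 'n::{finite,linorder} \<Rightarrow> 'a::banach"
  assumes "continuous_on D f" "t \<in> D"
  shows "coord_integral k f t = t $ k *\<^sub>R integral {0..1} (\<lambda>r. f (vec_upd t k (t $ k * r)))"
proof (cases "t $ k = 0")
  case False
  then have pos: "t $ k > 0" using rectangular_nonneg [OF assms(2), of k] by auto
  have "((\<lambda>s. f (vec_upd t k s)) has_integral coord_integral k f t) (cbox 0 (t $ k))"
    using integrable_integral [OF integrable_line [OF assms]] by (simp add: coord_integral_def)
  from has_integral_affinity [OF this, of "t $ k" 0]
  have "((\<lambda>r. f (vec_upd t k (t $ k * r))) has_integral (1 / (t $ k)) *\<^sub>R coord_integral k f t)
      ((\<lambda>x. x / (t $ k)) ` {0..t $ k})"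
    using pos by (simp add: divide_inverse mult.commute)
  moreover have "(\<lambda>x. x / (t $ k)) ` {0..t $ k} = {0..1}"
    using pos by (auto simp: image_iff field_simps intro!: bexI [of _ "_ * (t $ k)"])
  ultimately show ?thesis
    using pos by (simp add: integral_unique)
qed (simp add: coord_integral_def)

lemma continuous_on_coord_integral:
  fixes f :: "real ^ 'n::{finite,linorder} \<Rightarrow> 'a::banach"
  assumes "continuous_on D f"
  shows "continuous_on D (coord_integral k f)"
proof -
  have "vec_upd t k (t $ k * r) \<in> D" if "t \<in> D" "0 \<le> r" "r \<le> 1" for t r
    using that rectangular_nonneg [OF that(1), of k]
    by (intro vec_upd_mem) (auto simp: mult_left_le)
  then have "continuous_on (D \<times> cbox 0 1) (\<lambda>(t, r). f (vec_upd t k (t $ k * r)))"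
    unfolding split_beta
    by (intro continuous_on_compose2 [OF assms] continuous_on_vec_upd continuous_intros) auto
  then have "continuous_on D (\<lambda>t. integral (cbox 0 1) (\<lambda>r. f (vec_upd t k (t $ k * r))))"
    by (rule integral_continuous_on_param)
  then have "continuous_on D (\<lambda>t. t $ k *\<^sub>R integral {0..1} (\<lambda>r. f (vec_upd t k (t $ k * r))))"
    by (intro continuous_intros) auto
  then show ?thesis
    using coord_integral_rescale [OF assms] by (simp cong: continuous_on_cong)
qed

lemma continuous_on_fold_coord_integral:
  fixes f :: "real ^ 'n::{finite,linorder} \<Rightarrow> 'a::banach"
  assumes "continuous_on D f"
  shows "continuous_on D (fold coord_integral ks f)"
  by (induction ks rule: rev_induct) (auto simp: assms continuous_on_coord_integral)

lemma fold_coord_integral_diff: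
  fixes f g :: "real ^ 'n::{finite,linorder} \<Rightarrow> 'a::banach"
  assumes "continuous_on D f" "continuous_on D g" "t \<in> D"
  shows "fold coord_integral ks (\<lambda>t. f t - g t) t = fold coord_integral ks f t - fold coord_integral ks g t"
  using assms(3)
proof (induction ks arbitrary: t rule: rev_induct)
  case (snoc k ks)
  let ?f = "fold coord_integral ks f" and ?g = "fold coord_integral ks g"
  have "coord_integral k (fold coord_integral ks (\<lambda>t. f t - g t)) t
      = coord_integral k (\<lambda>t. ?f t - ?g t) t"
    using snoc by (intro coord_integral_cong) auto
  also have "\<dots> = coord_integral k ?f t - coord_integral k ?g t"
    unfolding coord_integral_def [of k]
    using snoc.prems assms by (intro integral_diff integrable_line continuous_on_fold_coord_integral)
  finally show ?case by simp
qed simp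

lemma coord_integral_has_derivative:
  fixes f :: "real ^ 'n::{finite,linorder} \<Rightarrow> 'a::banach"
  assumes "continuous_on D f" "t \<in> D"
  shows "((\<lambda>s. coord_integral k f (vec_upd t k s)) has_vector_derivative f t)
    (at (t $ k) within {s. vec_upd t k s \<in> D})"
proof -
  obtain b where b: "t $ k < b" "\<And>s. 0 \<le> s \<Longrightarrow> s \<le> b \<Longrightarrow> vec_upd t k s \<in> D"
    "at (t $ k) within {s. vec_upd t k s \<in> D} = at (t $ k) within {0..b}"
    using rectangular_line [OF assms(2), where k = k] by blast
  have "continuous_on {0..b} (\<lambda>s. f (vec_upd t k s))"
    using b by (intro continuous_on_line [OF assms(1)]) auto
  from integral_has_vector_derivative [OF this, of "t $ k"] show ?thesis
    using b rectangular_nonneg [OF assms(2)] by (simp add: coord_integral_def vec_upd_nth)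
qed

text \<open>After differentiating in the indices above \<open>k\<close>, the outermost integral left
  is the one in \<open>k\<close>, and the next derivative strips it. At \<open>K = {}\<close> this
  is the full integral, at \<open>K = UNIV\<close> it is \<open>g\<close> itself.\<close>

lemma deriv_chain_fold_coord_integral:
  fixes g :: "real ^ 'n::{finite,linorder} \<Rightarrow> 'a::banach"
  assumes "continuous_on D g"
  shows "deriv_chain D (\<lambda>K. fold coord_integral (sorted_list_of_set (- K)) g)"
  unfolding deriv_chain_def
proof (intro allI ballI)
  fix k :: 'n and t assume t: "t \<in> D"
  have "- {k<..} = {..k}" "- {k..} = {..<k}" by auto
  then show "((\<lambda>s. fold coord_integral (sorted_list_of_set (- {k<..})) g (vec_upd t k s))
      has_vector_derivative fold coord_integral (sorted_list_of_set (- {k..})) g t)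
      (at (t $ k) within {s. vec_upd t k s \<in> D})"
    using coord_integral_has_derivative [OF continuous_on_fold_coord_integral [OF assms] t, of k]
    by (simp add: sorted_list_of_set_atMost)
qed

text \<open>The intermediate derivatives need not be continuous, but every derivative is
  Henstock--Kurzweil integrable.\<close>

lemma deriv_chain_eq_full_integral:
  fixes G :: "'n set \<Rightarrow> real ^ 'n::{finite,linorder} \<Rightarrow> 'a::banach"
  assumes chain: "deriv_chain D G"
    and zero: "\<And>k t. t \<in> D \<Longrightarrow> t $ k = 0 \<Longrightarrow> G {k<..} t = 0"
    and t: "t \<in> D"
  shows "G {} t = full_integral (G UNIV) t"
proof -
  have step: "G {k<..} t = coord_integral k (G {k..}) t" if t: "t \<in> D" for k t
  proof -
    have "((\<lambda>s. G {k<..} (vec_upd t k s)) has_vector_derivative G {k..} (vec_upd t k s))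
        (at s within {0..t $ k})" if "s \<in> {0..t $ k}" for s
    proof -
      have s: "vec_upd t k s \<in> D" using vec_upd_mem [OF t] that by auto
      have "((\<lambda>s. G {k<..} (vec_upd t k s)) has_vector_derivative G {k..} (vec_upd t k s))
        (at s within {s. vec_upd t k s \<in> D})"
        using chain [unfolded deriv_chain_def, rule_format, OF s, of k] by (simp add: vec_upd_nth)
      then show ?thesis
        by (rule has_vector_derivative_within_subset) (use vec_upd_mem [OF t] in auto)
    qed
    then have "((\<lambda>s. G {k..} (vec_upd t k s)) has_integral
        G {k<..} (vec_upd t k (t $ k)) - G {k<..} (vec_upd t k 0)) {0..t $ k}"
      by (intro fundamental_theorem_of_calculus rectangular_nonneg t)
    moreover have "G {k<..} (vec_upd t k 0) = 0"
      using zero [of "vec_upd t k 0" k] vec_upd_mem [OF t, of 0 k] rectangular_nonneg [OF t, of k]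
      by (simp add: vec_upd_nth)
    ultimately show ?thesis
      by (simp add: coord_integral_def integral_unique)
  qed
  \<comment> \<open>The derivatives are integrated back in increasing order of the indices, starting
    from \<open>G UNIV\<close>; at the largest index no derivative is left.\<close>
  have eq: "\<forall>t\<in>D. G {k<..} t = fold coord_integral (sorted_list_of_set {..k}) (G UNIV) t" for k
  proof (induction "card {..k}" arbitrary: k rule: less_induct)
    case less
    have "\<forall>t\<in>D. G {k..} t = fold coord_integral (sorted_list_of_set {..<k}) (G UNIV) t"
    proof (cases k rule: lessThan_cases)
      case 1
      then have "{k..} = UNIV" by (metis Compl_lessThan Compl_empty_eq)
      then show ?thesis using 1 by simp
    next
      case (2 j)
      have "card {..j} < card {..k}"
        by (intro psubset_card_mono psubsetI) (use 2(1) in auto)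
      moreover have "{k..} = {j<..}" using 2(2) by (metis Compl_atMost Compl_lessThan)
      ultimately show ?thesis using less 2 by simp
    qed
    then show ?case
      using step by (auto simp: sorted_list_of_set_atMost intro!: coord_integral_cong)
  qed
  have "{Max (UNIV :: 'n set)<..} = {}" "{..Max (UNIV :: 'n set)} = UNIV"
    by (auto simp: not_less)
  then show ?thesis
    using eq [of "Max UNIV"] t by (simp add: full_integral_def)
qed

section \<open>Extension of the boundary data by inclusion and exclusion\<close>

definition boundary_extension ::
  "(real ^ 'n::{finite,linorder} \<Rightarrow> 'a::real_normed_vector) \<Rightarrow> 'n set \<Rightarrow> real ^ 'n::{finite,linorder} \<Rightarrow> 'a"
  where "boundary_extension \<phi> K t =
    (\<Sum>S | S \<noteq> {} \<and> S \<inter> K = {}. (-1) ^ (card S + 1) *\<^sub>R iter_partial_deriv D K \<phi> (zero_coords S t))"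

text \<open>A term with \<open>k\<close> in \<open>S\<close> is constant in coordinate
  \<open>k\<close> and drops out, which is why only sets disjoint from \<open>K\<close> are summed.
  In any other term \<open>S\<close> contains some \<open>j < k\<close>, so the point lies where
  \<open>admissible_boundary_data\<close> provides the derivative in \<open>k\<close>.\<close>

lemma deriv_chain_boundary_extension:
  assumes "admissible_boundary_data D \<phi>"
  shows "deriv_chain D (boundary_extension \<phi>)"
  unfolding deriv_chain_def
proof (intro allI ballI)
  fix k t assume t: "t \<in> D"
  let ?at = "at (t $ k) within {s. vec_upd t k s \<in> D}"
  let ?c = "\<lambda>S. (-1) ^ (card S + 1) :: real"
  let ?d = "\<lambda>S. if k \<in> S then 0 else iter_partial_deriv D {k..} \<phi> (zero_coords S t)"
  have "((\<lambda>s. iter_partial_deriv D {k<..} \<phi> (zero_coords S (vec_upd t k s))) has_vector_derivative ?d S) ?at"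
    if S: "S \<noteq> {}" "S \<inter> {k<..} = {}" for S
  proof (cases "k \<in> S")
    case True
    then show ?thesis by (simp add: zero_coords_vec_upd_in)
  next
    case False
    let ?u = "zero_coords S t"
    have u: "?u \<in> D" by (rule zero_coords_mem [OF t])
    obtain j where j: "j \<in> S" "j < k"
      using S False by (metis disjoint_iff equals0I greaterThan_iff linorder_neqE)
    then have "Min UNIV < k" by (meson Min_le UNIV_I finite order.strict_trans1)
    moreover have "(\<Prod>i<k. ?u $ i) = 0"
      using j by (auto simp: zero_coords_nth)
    ultimately have "partially_differentiable D k (iter_partial_deriv D {k<..} \<phi>) ?u"
      using assms u unfolding admissible_boundary_data_def by auto
    then have "((\<lambda>s. iter_partial_deriv D {k<..} \<phi> (vec_upd ?u k s)) has_vector_derivative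
        iter_partial_deriv D {k..} \<phi> ?u) (at (?u $ k) within {s. vec_upd ?u k s \<in> D})"
      by (simp add: partially_differentiable_def iter_partial_deriv_atLeast partial_deriv_def
          vector_derivative_works)
    \<comment> \<open>The line through \<open>t\<close> may leave \<open>D\<close> earlier than the
      line through \<open>?u\<close>, so the derivative is restricted to a smaller set of
      parameters.\<close>
    moreover have "{s. vec_upd t k s \<in> D} \<subseteq> {s. vec_upd ?u k s \<in> D}"
      using zero_coords_mem zero_coords_vec_upd_notin [OF False] by (metis (mono_tags) Collect_mono)
    ultimately show ?thesis
      using False
      by (auto simp: zero_coords_vec_upd_notin zero_coords_nth intro: has_vector_derivative_within_subset)
  qed
  then have "((\<lambda>s. boundary_extension \<phi> {k<..} (vec_upd t k s)) has_vector_derivative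
      (\<Sum>S | S \<noteq> {} \<and> S \<inter> {k<..} = {}. ?c S *\<^sub>R ?d S)) ?at"
    unfolding boundary_extension_def
    by (intro has_vector_derivative_sum
        bounded_linear.has_vector_derivative [OF bounded_linear_scaleR_right]) auto
  moreover have "(\<Sum>S | S \<noteq> {} \<and> S \<inter> {k<..} = {}. ?c S *\<^sub>R ?d S) = boundary_extension \<phi> {k..} t"
    unfolding boundary_extension_def
  proof (intro sum.mono_neutral_cong_right ballI)
    show "{S. S \<noteq> {} \<and> S \<inter> {k..} = {}} \<subseteq> {S. S \<noteq> {} \<and> S \<inter> {k<..} = {}}"
      by (auto simp: disjoint_iff)
    show "?c S *\<^sub>R ?d S = 0"
      if "S \<in> {S. S \<noteq> {} \<and> S \<inter> {k<..} = {}} - {S. S \<noteq> {} \<and> S \<inter> {k..} = {}}" for S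
    proof -
      have "k \<in> S" using that by (auto simp: disjoint_iff)
      then show ?thesis by simp
    qed
  qed (auto simp: disjoint_iff)
  ultimately show "((\<lambda>s. boundary_extension \<phi> {k<..} (vec_upd t k s)) has_vector_derivative
      boundary_extension \<phi> {k..} t) ?at" by simp
qed

text \<open>No nonempty set is disjoint from all indices, so the sum is empty: the extension
  contributes nothing to the full mixed derivative.\<close>

lemma boundary_extension_UNIV: "boundary_extension \<phi> UNIV t = 0"
  by (simp add: boundary_extension_def)

lemma boundary_extension_empty:
  "boundary_extension \<phi> {} t = (\<Sum>S | S \<noteq> {}. (-1) ^ (card S + 1) *\<^sub>R \<phi> (zero_coords S t))"
  by (simp add: boundary_extension_def iter_partial_deriv_def)

lemma zero_face_iff: "t \<in> zero_face D \<longleftrightarrow> t \<in> D \<and> (\<exists>k. t $ k = 0)"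
  by (auto simp: zero_face_def)

lemma zero_coords_face:
  assumes "S \<noteq> {}" "t \<in> D"
  shows "zero_coords S t \<in> zero_face D"
proof -
  obtain k where "k \<in> S" using assms(1) by blast
  then have "zero_coords S t $ k = 0" by (simp add: zero_coords_nth)
  then show ?thesis using zero_coords_mem [OF assms(2)] by (auto simp: zero_face_iff)
qed

lemma continuous_on_boundary_extension:
  assumes "continuous_on (zero_face D) \<phi>"
  shows "continuous_on D (boundary_extension \<phi> {})"
  unfolding boundary_extension_empty [abs_def]
proof (intro continuous_intros)
  fix S :: "'n set" assume "S \<in> {S. S \<noteq> {}}"
  then show "continuous_on D (\<lambda>t. \<phi> (zero_coords S t))"
    by (intro continuous_on_compose2 [OF assms] continuous_on_zero_coords)
      (use zero_coords_face in blast)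
qed

text \<open>On this face \<open>S\<close> and \<open>insert k S\<close> give the same point with
  opposite signs, so the sum over all subsets is 0. The term of the empty set is minus
  \<open>\<phi> t\<close>, and moving it to the other side gives the claim.\<close>

lemma boundary_extension_face:
  assumes "t $ k = 0"
  shows "boundary_extension \<phi> {} t = \<phi> t"
proof -
  let ?f = "\<lambda>S. (-1) ^ (card S + 1) *\<^sub>R \<phi> (zero_coords S t)"
  have inj: "inj_on (insert k) (Pow (- {k}))"
    by (auto simp: inj_on_def)
  have "UNIV = Pow (- {k}) \<union> insert k ` Pow (- {k})"
  proof -
    have "S \<in> Pow (- {k}) \<union> insert k ` Pow (- {k})" for S
      by (cases "k \<in> S") (auto intro: image_eqI [of _ _ "S - {k}"])
    then show ?thesis by blast
  qed
  then have "sum ?f UNIV = sum ?f (Pow (- {k})) + sum ?f (insert k ` Pow (- {k}))"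
    by (metis (no_types, lifting) ComplD PowD disjoint_iff finite image_iff insertI1 subsetD sum.union_disjoint)
  also have "sum ?f (insert k ` Pow (- {k})) = (\<Sum>S\<in>Pow (- {k}). ?f (insert k S))"
    by (simp add: sum.reindex [OF inj])
  also have "\<dots> = (\<Sum>S\<in>Pow (- {k}). - ?f S)"
  proof (rule sum.cong [OF refl])
    fix S assume "S \<in> Pow (- {k})"
    then have "k \<notin> S" by auto
    moreover have "zero_coords (insert k S) t = zero_coords S t"
      using assms by (auto simp: vec_eq_iff zero_coords_nth)
    ultimately show "?f (insert k S) = - ?f S" by simp
  qed
  finally have "sum ?f UNIV = 0" by (simp add: sum_negf)
  moreover have "sum ?f UNIV = ?f {} + sum ?f {S. S \<noteq> {}}"
    by (subst sum.remove [of _ "{}"]) (auto intro!: sum.cong)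
  moreover have "zero_coords {} t = t" by (simp add: vec_eq_iff zero_coords_nth)
  ultimately show ?thesis
    unfolding boundary_extension_empty by simp
qed

section \<open>Estimates with an exponential weight\<close>

lemma coord_integral_exp_bound:
  fixes f :: "real ^ 'n::{finite,linorder} \<Rightarrow> 'a::banach"
  assumes "continuous_on D f" "u \<in> D" "\<mu> > 0"
    and bound: "\<And>t. t \<in> {0..u} \<Longrightarrow> norm (f t) \<le> C * exp (\<mu> * (\<Sum>i\<in>UNIV. t $ i))"
    and t: "t \<in> {0..u}"
  shows "norm (coord_integral k f t) \<le> C / \<mu> * exp (\<mu> * (\<Sum>i\<in>UNIV. t $ i))"
proof -
  have tD: "t \<in> D" using rectangular_interval assms t by blast
  have C: "C \<ge> 0"
    using order_trans [OF norm_ge_zero bound [OF t]] by (simp add: zero_le_mult_iff)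
  \<comment> \<open>\<open>?h s\<close> is the weight at \<open>vec_upd t k s\<close>, so
    integrating it in \<open>s\<close> costs a factor \<open>1 / \<mu>\<close>. The contribution of
    the lower endpoint has a favourable sign and is dropped at the end.\<close>
  let ?h = "\<lambda>s. exp (\<mu> * ((\<Sum>i\<in>UNIV. t $ i) - t $ k + s))"
  have sum_upd: "(\<Sum>i\<in>UNIV. vec_upd t k s $ i) = (\<Sum>i\<in>UNIV. t $ i) - t $ k + s" for s
    by (simp add: vec_upd_nth sum.remove [of UNIV k])
  have "((\<lambda>s. C * ?h s) has_integral C / \<mu> * ?h (t $ k) - C / \<mu> * ?h 0) {0..t $ k}"
    using assms(3)
    by (intro fundamental_theorem_of_calculus rectangular_nonneg tD)
      (auto intro!: derivative_eq_intros simp flip: has_real_derivative_iff_has_vector_derivative)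
  then have int: "integral {0..t $ k} (\<lambda>s. C * ?h s) = C / \<mu> * ?h (t $ k) - C / \<mu> * ?h 0"
    "(\<lambda>s. C * ?h s) integrable_on {0..t $ k}"
    by (rule integral_unique, rule has_integral_integrable)
  have "norm (coord_integral k f t) \<le> integral {0..t $ k} (\<lambda>s. C * ?h s)"
    unfolding coord_integral_def
  proof (intro integral_norm_bound_integral integrable_line assms tD int)
    fix s assume "s \<in> {0..t $ k}"
    then have "vec_upd t k s \<in> {0..u}"
      using t by (auto simp: less_eq_vec_def vec_upd_nth intro: order_trans)
    then show "norm (f (vec_upd t k s)) \<le> C * ?h s"
      using bound by (simp add: sum_upd [symmetric])
  qed
  also have "\<dots> \<le> C / \<mu> * ?h (t $ k)"
    unfolding int(1) using C assms(3) by simp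
  finally show ?thesis by simp
qed

text \<open>Every integration contributes a factor \<open>1 / \<mu>\<close>. As there is at least
  one index and \<open>\<mu> \<ge> 1\<close>, the product of these factors is at most
  \<open>1 / \<mu>\<close>.\<close>

lemma full_integral_exp_bound:
  fixes f :: "real ^ 'n::{finite,linorder} \<Rightarrow> 'a::banach"
  assumes "continuous_on D f" "u \<in> D" "\<mu> \<ge> 1"
    and bound: "\<And>t. t \<in> {0..u} \<Longrightarrow> norm (f t) \<le> C * exp (\<mu> * (\<Sum>i\<in>UNIV. t $ i))"
    and t: "t \<in> {0..u}"
  shows "norm (full_integral f t) \<le> C / \<mu> * exp (\<mu> * (\<Sum>i\<in>UNIV. t $ i))"
proof -
  have C: "C \<ge> 0"
    using order_trans [OF norm_ge_zero bound [OF t]] by (simp add: zero_le_mult_iff)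
  have "norm (fold coord_integral ks f t) \<le> C / \<mu> ^ length ks * exp (\<mu> * (\<Sum>i\<in>UNIV. t $ i))"
    if "t \<in> {0..u}" for ks t
    using that
  proof (induction ks arbitrary: t rule: rev_induct)
    case (snoc k ks)
    show ?case
      using coord_integral_exp_bound [OF continuous_on_fold_coord_integral [OF assms(1)] assms(2) _ snoc.IH]
        snoc.prems assms(3) by (simp add: mult.commute)
  qed (use bound in simp)
  from this [OF t, of "sorted_list_of_set UNIV"]
  have "norm (full_integral f t) \<le> C / \<mu> ^ CARD('n) * exp (\<mu> * (\<Sum>i\<in>UNIV. t $ i))"
    by (simp add: full_integral_def)
  also have "\<dots> \<le> C / \<mu> * exp (\<mu> * (\<Sum>i\<in>UNIV. t $ i))"
  proof -
    have "\<mu> ^ 1 \<le> \<mu> ^ CARD('n)"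
      using assms(3) by (intro power_increasing) (auto simp: Suc_le_eq)
    then show ?thesis
      using C assms(3) by (intro mult_right_mono divide_left_mono) auto
  qed
  finally show ?thesis .
qed

section \<open>Picard iteration for the integral equation\<close>

context
  fixes F :: "(real ^ 'n::{finite,linorder}) \<times> 'a::banach \<Rightarrow> 'a"
    and L :: "real ^ 'n::{finite,linorder} \<Rightarrow> real"
  assumes cont_F: "continuous_on (D \<times> UNIV) F"
    and cont_L: "continuous_on D L"
    and lipschitz: "\<And>t x y. t \<in> D \<Longrightarrow> norm (F (t, x) - F (t, y)) \<le> L t * norm (x - y)"
begin

lemma continuous_on_superposition:
  "continuous_on D x \<Longrightarrow> continuous_on D (\<lambda>t. F (t, x t))"
  by (intro continuous_on_compose2 [OF cont_F] continuous_intros) auto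

lemma full_integral_diff:
  assumes "continuous_on D x" "continuous_on D y" "t \<in> D"
  shows "full_integral (\<lambda>t. F (t, x t)) t - full_integral (\<lambda>t. F (t, y t)) t
    = full_integral (\<lambda>t. F (t, x t) - F (t, y t)) t"
  unfolding full_integral_def
  using assms by (intro fold_coord_integral_diff [symmetric] continuous_on_superposition)

lemma full_integral_contraction:
  assumes "u \<in> D"
  obtains \<mu> where "\<mu> \<ge> 1" "exp_contraction D (\<lambda>x. full_integral (\<lambda>t. F (t, x t))) u \<mu>"
proof -
  have "compact (L ` {0..u})"
    using continuous_on_subset [OF cont_L rectangular_interval [OF assms]]
    by (intro compact_continuous_image) auto
  then obtain B where B: "\<And>t. t \<in> {0..u} \<Longrightarrow> norm (L t) \<le> B"
    using compact_imp_bounded bounded_iff by (metis image_eqI)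
  \<comment> \<open>The Lipschitz estimate costs at most \<open>B \<le> \<mu> / 2\<close> and the
    integration gains \<open>1 / \<mu>\<close>, which leaves the factor \<open>1 / 2\<close>. The
    maximum with 1 meets the assumption of \<open>full_integral_exp_bound\<close>.\<close>
  define \<mu> where "\<mu> = max 1 (2 * B)"
  have \<mu>: "\<mu> \<ge> 1" "B \<le> \<mu> / 2" by (auto simp: \<mu>_def)
  have "norm (full_integral (\<lambda>t. F (t, x t)) t - full_integral (\<lambda>t. F (t, y t)) t)
      \<le> C / 2 * exp (\<mu> * (\<Sum>i\<in>UNIV. t $ i))"
    if x: "continuous_on D x" and y: "continuous_on D y"
      and le: "\<forall>t\<in>{0..u}. norm (x t - y t) \<le> C * exp (\<mu> * (\<Sum>i\<in>UNIV. t $ i))" and t: "t \<in> {0..u}"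
    for x y C t
  proof -
    let ?w = "\<lambda>t :: real ^ 'n::{finite,linorder}. exp (\<mu> * (\<Sum>i\<in>UNIV. t $ i))"
    have "norm (F (t, x t) - F (t, y t)) \<le> \<mu> * C / 2 * ?w t" if t: "t \<in> {0..u}" for t
    proof -
      have "norm (F (t, x t) - F (t, y t)) \<le> L t * norm (x t - y t)"
        using lipschitz rectangular_interval [OF assms] t by blast
      also have "\<dots> \<le> \<mu> / 2 * (C * ?w t)"
        using B [OF t] \<mu> le t by (intro mult_mono) auto
      finally show ?thesis by simp
    qed
    moreover have "continuous_on D (\<lambda>t. F (t, x t) - F (t, y t))"
      by (intro continuous_on_diff continuous_on_superposition x y)
    ultimately have "norm (full_integral (\<lambda>t. F (t, x t) - F (t, y t)) t) \<le> \<mu> * C / 2 / \<mu> * ?w t"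
      using full_integral_exp_bound [OF _ assms \<mu>(1) _ t] by blast
    moreover have "t \<in> D" using rectangular_interval [OF assms] t by blast
    ultimately show ?thesis
      using \<mu>(1) by (simp add: full_integral_diff [OF x y])
  qed
  then show ?thesis
    using \<mu>(1) by (intro that [of \<mu>]) (auto simp: exp_contraction_def)
qed

text \<open>Feeding the bound for \<open>x - y\<close> back into the contraction halves it each
  time, so the difference is 0. The equation is assumed only for the difference, since this is what
  two solutions with common boundary data yield directly.\<close>

lemma full_integral_equation_unique:
  assumes x: "continuous_on D x" and y: "continuous_on D y"
    and eq: "\<And>t. t \<in> D \<Longrightarrow>
      x t - y t = full_integral (\<lambda>t. F (t, x t)) t - full_integral (\<lambda>t. F (t, y t)) t"
    and u: "u \<in> D"
  shows "x u = y u"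
proof -
  let ?I = "{0..u}"
  have uI: "u \<in> ?I" using rectangular_nonneg [OF u] by (simp add: less_eq_vec_def)
  obtain \<mu> where "\<mu> \<ge> 1"
    and contr: "exp_contraction D (\<lambda>x. full_integral (\<lambda>t. F (t, x t))) u \<mu>"
    using full_integral_contraction [OF u] by blast
  let ?w = "\<lambda>t :: real ^ 'n::{finite,linorder}. exp (\<mu> * (\<Sum>i\<in>UNIV. t $ i))"
  have "compact ((\<lambda>t. x t - y t) ` ?I)"
    using continuous_on_subset [OF _ rectangular_interval [OF u]] x y
    by (intro compact_continuous_image continuous_intros) auto
  then obtain B where B: "\<And>t. t \<in> ?I \<Longrightarrow> norm (x t - y t) \<le> B"
    using compact_imp_bounded bounded_iff by (metis (no_types, lifting) image_eqI)
  have bound: "\<forall>t\<in>?I. norm (x t - y t) \<le> B / 2 ^ j * ?w t" for j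
  proof (induction j)
    case 0
    have "norm (x t - y t) \<le> B * ?w t" if t: "t \<in> ?I" for t
    proof -
      have "1 \<le> ?w t" by (rule one_le_exp_sum [OF t \<open>\<mu> \<ge> 1\<close>])
      then have "norm (x t - y t) * 1 \<le> B * ?w t"
        using B [OF t] norm_ge_zero [of "x t - y t"] by (intro mult_mono) linarith+
      then show ?thesis by simp
    qed
    then show ?case by simp
  next
    case (Suc j)
    show ?case
    proof
      fix t assume t: "t \<in> ?I"
      then have "t \<in> D" using rectangular_interval [OF u] by blast
      then show "norm (x t - y t) \<le> B / 2 ^ Suc j * ?w t"
        using exp_contractionD [OF contr x y Suc] t eq [of t] by (simp add: mult.commute)
    qed
  qed
  have "(\<lambda>j. B * ?w u * (1 / 2) ^ j) \<longlonglongrightarrow> B * ?w u * 0"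
    by (intro tendsto_intros LIMSEQ_power_zero) auto
  then have "norm (x u - y u) \<le> 0"
    using bound uI by (intro LIMSEQ_le_const [of _ 0]) (auto simp: power_divide mult.commute)
  then show ?thesis by simp
qed

lemma full_integral_equation_solvable:
  assumes \<Phi>: "continuous_on D \<Phi>"
  obtains x where "continuous_on D x"
    "\<And>t. t \<in> D \<Longrightarrow> x t = \<Phi> t + full_integral (\<lambda>t. F (t, x t)) t"
proof -
  define T where "T x t = \<Phi> t + full_integral (\<lambda>t. F (t, x t)) t" for x t
  define X where "X n = (T ^^ n) \<Phi>" for n
  \<comment> \<open>The limit is a telescoping series that mentions no rectangle, so the uniform
    limits on different rectangles are the same function.\<close>
  define x where "x t = X 0 t + (\<Sum>j. X (Suc j) t - X j t)" for t
  have cont_T: "continuous_on D (T y)" if "continuous_on D y" for y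
    unfolding T_def full_integral_def
    by (intro continuous_intros \<Phi> continuous_on_fold_coord_integral continuous_on_superposition that)
  have cont_X: "continuous_on D (X n)" for n
    unfolding X_def by (induction n) (auto simp: \<Phi> cont_T)
  have contraction: "\<exists>\<mu>\<ge>1. exp_contraction D T u \<mu>" if "u \<in> D" for u
    \<comment> \<open>The summand \<open>\<Phi>\<close> cancels in
      \<open>T x t - T y t\<close>.\<close>
    by (rule full_integral_contraction [OF that]) (auto simp: exp_contraction_def T_def)
  have limit: "uniform_limit {0..u} X x sequentially" if u: "u \<in> D" for u
  proof -
    let ?I = "{0..u}"
    obtain \<mu> where \<mu>: "\<mu> \<ge> 1" and contr: "exp_contraction D T u \<mu>"
      using contraction [OF u] by blast
    let ?w = "\<lambda>t :: real ^ 'n::{finite,linorder}. exp (\<mu> * (\<Sum>i\<in>UNIV. t $ i))"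
    have "compact ((\<lambda>t. X 1 t - X 0 t) ` ?I)"
      by (intro compact_continuous_image continuous_intros
          continuous_on_subset [OF cont_X rectangular_interval [OF u]]) auto
    then obtain B where B: "\<And>t. t \<in> ?I \<Longrightarrow> norm (X 1 t - X 0 t) \<le> B"
      using compact_imp_bounded bounded_iff by (metis (no_types, lifting) image_eqI)
    have w: "1 \<le> ?w t" "?w t \<le> ?w u" if "t \<in> ?I" for t
      using that \<mu> one_le_exp_sum [OF that \<mu>] by (auto simp: less_eq_vec_def intro!: sum_mono)
    have bound: "\<forall>t\<in>?I. norm (X (Suc j) t - X j t) \<le> B / 2 ^ j * ?w t" for j
    proof (induction j)
      case 0
      have "norm (X 1 t - X 0 t) \<le> B * ?w t" if t: "t \<in> ?I" for t
      proof -
        have "norm (X 1 t - X 0 t) * 1 \<le> B * ?w t"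
          using B [OF t] norm_ge_zero [of "X 1 t - X 0 t"] w [OF t] by (intro mult_mono) linarith+
        then show ?thesis by simp
      qed
      then show ?case by simp
    next
      case (Suc j)
      have "X (Suc n) = T (X n)" for n by (simp add: X_def)
      then show ?case
        using exp_contractionD [OF contr cont_X [of "Suc j"] cont_X [of j] Suc] by (simp add: mult.commute)
    qed
    have "uniform_limit ?I (\<lambda>n t. \<Sum>j<n. X (Suc j) t - X j t) (\<lambda>t. \<Sum>j. X (Suc j) t - X j t) sequentially"
    proof (rule Weierstrass_m_test)
      show "norm (X (Suc j) t - X j t) \<le> B * ?w u * (1 / 2) ^ j" if t: "t \<in> ?I" for j t
      proof -
        have "0 \<le> B" using order_trans [OF norm_ge_zero B [OF t]] .
        then have "B / 2 ^ j * ?w t \<le> B / 2 ^ j * ?w u"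
          using w [OF t] by (intro mult_left_mono) auto
        then show ?thesis
          using bound [of j] t by (force simp: power_divide)
      qed
      show "summable (\<lambda>j. B * ?w u * (1 / 2) ^ j)"
        by (intro summable_mult summable_geometric) auto
    qed
    then have "uniform_limit ?I (\<lambda>n t. X 0 t + (\<Sum>j<n. X (Suc j) t - X j t)) x sequentially"
      unfolding x_def by (intro uniform_limit_add uniform_limit_const)
    then show "uniform_limit ?I X x sequentially"
      by (simp add: sum_lessThan_telescope [where f = "\<lambda>j. X j _"])
  qed
  have cont_x: "continuous_on D x"
    unfolding continuous_on_eq_continuous_within
  proof
    fix t assume t: "t \<in> D"
    \<comment> \<open>As \<open>u\<close> exceeds \<open>t\<close> strictly in every coordinate, the
      rectangle below \<open>u\<close> is a neighbourhood of \<open>t\<close> relative to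
      \<open>D\<close>, and continuity on it suffices.\<close>
    obtain u where u: "u \<in> D" "\<And>i. t $ i < u $ i"
      using rectangular_above [OF t] by blast
    have "continuous_on {0..u} x"
      using limit [OF u(1)] continuous_on_subset [OF cont_X rectangular_interval [OF u(1)]]
      by (intro uniform_limit_theorem) auto
    moreover have tI: "t \<in> {0..u}"
      using u rectangular_nonneg [OF t] by (auto simp: less_eq_vec_def less_imp_le)
    moreover have "at t within D = at t within {0..u}"
    proof (rule at_within_nhd)
      show "open (\<Inter>i. {v :: real ^ 'n::{finite,linorder}. v $ i < u $ i})"
        by (intro open_INT ballI open_Collect_less continuous_intros) auto
      show "D \<inter> (\<Inter>i. {v. v $ i < u $ i}) - {t} = {0..u} \<inter> (\<Inter>i. {v. v $ i < u $ i}) - {t}"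
        using rectangular_nonneg rectangular_interval [OF u(1)]
        by (auto simp: less_eq_vec_def less_imp_le)
    qed (use u in auto)
    ultimately show "continuous (at t within D) x"
      by (simp add: continuous_on_eq_continuous_within continuous_within)
  qed
  have "x u = T x u" if u: "u \<in> D" for u
  proof (rule LIMSEQ_unique)
    have uI: "u \<in> {0..u}" using rectangular_nonneg [OF u] by (simp add: less_eq_vec_def)
    show "(\<lambda>n. X (Suc n) u) \<longlonglongrightarrow> x u"
      using tendsto_uniform_limitI [OF limit [OF u] uI] by (rule LIMSEQ_Suc)
    obtain \<mu> where \<mu>: "\<mu> \<ge> 1" and contr: "exp_contraction D T u \<mu>"
      using contraction [OF u] by blast
    let ?w = "\<lambda>t :: real ^ 'n::{finite,linorder}. exp (\<mu> * (\<Sum>i\<in>UNIV. t $ i))"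
    show "(\<lambda>n. X (Suc n) u) \<longlonglongrightarrow> T x u"
      unfolding tendsto_iff
    proof (intro allI impI)
      fix r :: real assume r: "r > 0"
      \<comment> \<open>Because the weight is at least 1, uniform closeness \<open>r / ?w u\<close>
        is a weighted bound with this \<open>C\<close>; at \<open>u\<close> the contraction turns it
        into \<open>r / 2\<close>.\<close>
      then have "r / ?w u > 0" by simp
      with limit [OF u] have "\<forall>\<^sub>F n in sequentially. \<forall>t\<in>{0..u}. dist (X n t) (x t) < r / ?w u"
        by (rule uniform_limitD)
      then show "\<forall>\<^sub>F n in sequentially. dist (X (Suc n) u) (T x u) < r"
      proof eventually_elim
        case (elim n)
        have "norm (X n t - x t) \<le> r / ?w u * ?w t" if t: "t \<in> {0..u}" for t
        proof -
          have "1 \<le> ?w t" by (rule one_le_exp_sum [OF t \<mu>])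
          then have "r / ?w u * 1 \<le> r / ?w u * ?w t"
            using r by (intro mult_left_mono) auto
          then show ?thesis using elim t by (force simp: dist_norm)
        qed
        then have "norm (T (X n) u - T x u) \<le> r / ?w u / 2 * ?w u"
          using exp_contractionD [OF contr cont_X cont_x] uI by blast
        then show ?case using r by (simp add: dist_norm X_def)
      qed
    qed
  qed
  then show ?thesis using that [OF cont_x] unfolding T_def by blast
qed

section \<open>Uniqueness and existence for the Cauchy problem\<close>

lemma cauchy_solution_unique:
  assumes x: "continuous_on D x" "cauchy_solution D F \<phi> x"
    and y: "continuous_on D y" "cauchy_solution D F \<phi> y"
    and t: "t \<in> D"
  shows "x t = y t"
proof (rule full_integral_equation_unique [OF x(1) y(1) _ t])
  fix t assume t: "t \<in> D"
  let ?G = "\<lambda>K t. iter_partial_deriv D K x t - iter_partial_deriv D K y t"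
  have "deriv_chain D ?G"
    using x(2) y(2)
    by (intro deriv_chain_diff deriv_chain_iter_partial_deriv) (auto simp: cauchy_solution_def)
  \<comment> \<open>Both solutions equal \<open>\<phi>\<close> on the face, and the derivatives in
    the indices above \<open>k\<close> do not leave it; the fundamental theorem then produces no
    boundary terms.\<close>
  moreover have "?G {k<..} t = 0" if "t \<in> D" "t $ k = 0" for k t
  proof -
    have "x s = y s" if "s \<in> D" "s $ k = 0" for s
      using x(2) y(2) that unfolding cauchy_solution_def by (metis zero_face_iff)
    then show ?thesis
      using iter_partial_deriv_cong_face [of D k x y "{k<..}" t] that by simp
  qed
  ultimately have "?G {} t = full_integral (?G UNIV) t"
    using t by (rule deriv_chain_eq_full_integral)
  also have "\<dots> = full_integral (\<lambda>t. F (t, x t) - F (t, y t)) t"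
    using x(2) y(2) t by (intro full_integral_cong) (auto simp: cauchy_solution_def)
  finally show "x t - y t = full_integral (\<lambda>t. F (t, x t)) t - full_integral (\<lambda>t. F (t, y t)) t"
    using full_integral_diff [OF x(1) y(1) t] by (simp add: iter_partial_deriv_def)
qed

text \<open>The two summands of the integral equation have explicit derivative chains. At
  \<open>UNIV\<close> the boundary part is 0 and no integration remains, so the mixed derivative is
  the right-hand side of the Cauchy problem.\<close>

lemma cauchy_solution_exists:
  assumes "admissible_boundary_data D \<phi>"
  obtains x where "x \<in> extensional D" "continuous_on D x" "cauchy_solution D F \<phi> x"
proof -
  have "continuous_on D (boundary_extension \<phi> {})"
    using assms by (intro continuous_on_boundary_extension) (simp add: admissible_boundary_data_def)
  then obtain y where y: "continuous_on D y"
    "\<And>t. t \<in> D \<Longrightarrow> y t = boundary_extension \<phi> {} t + full_integral (\<lambda>t. F (t, y t)) t"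
    by (rule full_integral_equation_solvable) metis
  \<comment> \<open>Fixing the values outside \<open>D\<close> makes uniqueness of the solution an
    equality of total functions.\<close>
  define x where "x = restrict y D"
  have xy: "x t = y t" if "t \<in> D" for t
    using that by (simp add: x_def)
  let ?J = "\<lambda>K. fold coord_integral (sorted_list_of_set (- K)) (\<lambda>t. F (t, y t))"
  let ?G = "\<lambda>K t. boundary_extension \<phi> K t + ?J K t"
  have chain: "deriv_chain D ?G"
    by (intro deriv_chain_add deriv_chain_boundary_extension deriv_chain_fold_coord_integral
        continuous_on_superposition assms y)
  have eq: "x t = ?G {} t" if "t \<in> D" for t
    using y(2) that by (simp add: x_def full_integral_def)
  have "{Min (UNIV :: 'n set)..} = UNIV" by auto
  then have "iter_partial_deriv D UNIV x t = F (t, x t)" if "t \<in> D" for t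
    using deriv_chain_iter(2) [OF chain eq that, of "Min UNIV"] that
    by (simp add: boundary_extension_UNIV xy)
  moreover have "x t = \<phi> t" if "t \<in> zero_face D" for t
  proof -
    obtain k where k: "t \<in> D" "t $ k = 0" using \<open>t \<in> zero_face D\<close> by (auto simp: zero_face_iff)
    then show ?thesis
      using eq [OF k(1)] boundary_extension_face [OF k(2)] by (simp add: fold_coord_integral_zero)
  qed
  ultimately have "cauchy_solution D F \<phi> x"
    using deriv_chain_iter(3) [OF chain eq] by (simp add: cauchy_solution_def)
  moreover have "continuous_on D x"
    using y(1) by (simp add: x_def cong: continuous_on_cong)
  ultimately show ?thesis by (intro that) (auto simp: x_def)
qed

end

end

theorem corollary6:
  fixes D :: "(real ^ 'n::{finite,linorder}) set"
    and F :: "(real ^ 'n::{finite,linorder}) \<times> (real ^ 'm) \<Rightarrow> real ^ 'm"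
    and L :: "real ^ 'n::{finite,linorder} \<Rightarrow> real"
    and \<phi> :: "real ^ 'n::{finite,linorder} \<Rightarrow> real ^ 'm"
  assumes "rectangular D"
    and "continuous_on (D \<times> UNIV) F"
    and "continuous_on D L"
    and "\<And>t. t \<in> D \<Longrightarrow> L t > 0"
    and "\<And>t x y. t \<in> D \<Longrightarrow> norm (F (t, x) - F (t, y)) \<le> L t * norm (x - y)"
    and "admissible_boundary_data D \<phi>"
  shows "\<exists>!x. x \<in> extensional D \<and> continuous_on D x \<and> cauchy_solution D F \<phi> x"
proof -
  obtain x where x: "x \<in> extensional D" "continuous_on D x" "cauchy_solution D F \<phi> x"
    by (rule cauchy_solution_exists [OF assms(1,2,3,5,6)])
  show ?thesis
  proof (rule ex1I [of _ x])
    fix y assume "y \<in> extensional D \<and> continuous_on D y \<and> cauchy_solution D F \<phi> y"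
    then show "y = x"
      using x cauchy_solution_unique [OF assms(1,2,3,5)] by (metis extensionalityI)
  qed (use x in auto)
qed

end
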